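(* $\mathcal{SD}=\mathcal{I}_{\mathrm{anti}}$.
   Context: $\mathcal{B}_k$ is the set of functions $\{0,1\}^k\to\mathbb{R}_{\ge0}$, $\mathcal{B}=\bigcup_k\mathcal{B}_k$, with $\mathcal{B}_0$ identified with $\mathbb{R}_{\ge0}$. $\mathcal{SD}=\{f\in\mathcal{B}:f(\mathbf{x})=f(\overline{\mathbf{x}})\ \forall\mathbf{x}\}$, $\overline{\mathbf{x}}$ the bitwise complement. $\mathrm{EQ}$ is the binary equality indicator. $\langle\mathcal{F}\rangle$ is the closure of $\mathcal{F}\cup\{\mathrm{EQ}\}$ under introducing fictitious arguments, permuting arguments, pointwise product of equal-arity functions, and summing out an argument over $\{0,1\}$; a $k$-ary $f$ is a limit of $\mathcal{F}$ if there is a finite $S\subseteq\mathcal{F}$ such that for all $\epsilon>0$ some $k$-ary $f_\epsilon\in\langle S\rangle$ has $\max_\mathbf{x}|f-f_\epsilon|<\epsilon$; $\langle\mathcal{F}\rangle_\omega$ is the closure of $\mathcal{F}\cup\{\mathrm{EQ}\}$ under the four operations and limits. $\mathrm{Ising}_2^\lambda$ is the binary function with value 1 on $(0,0),(1,1)$ and $\lambda$ on $(0,1),(1,0)$; $\mathcal{I}_{\mathrm{anti}}=\langle\{\mathrm{Ising}_2^\lambda:\lambda\ge1\}\cup\mathcal{B}_0\rangle_\omega$. *)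

theory Defs
  imports Complex_Main "HOL-Library.FuncSet" "HOL-Combinatorics.Permutations"
begin

text \<open>
  Boolean tuples are lists of booleans, with \<^term>\<open>False\<close> for 0 and \<^term>\<open>True\<close> for 1; argument
  positions count from 0.  A k-ary function is extensional on tuples of length k and is always
  paired with its arity k, so that functions of different arities are distinct objects.
\<close>

type_synonym bfun = "nat \<times> (bool list \<Rightarrow> real)"

definition cube :: "nat \<Rightarrow> bool list set"
  where "cube k = {xs. length xs = k}"

definition BF_arity :: "nat \<Rightarrow> bfun set"
  where "BF_arity k = {k} \<times> (cube k \<rightarrow>\<^sub>E {0..})"

definition BF :: "bfun set"
  where "BF = (\<Union>k. BF_arity k)"

definition SD :: "bfun set"
  where "SD = {(k, f) \<in> BF. \<forall>x\<in>cube k. f x = f (map Not x)}"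

definition EQ :: bfun
  where "EQ = (2, \<lambda>x\<in>cube 2. if x ! 0 = x ! 1 then 1 else 0)"

definition Ising2 :: "real \<Rightarrow> bfun"
  where "Ising2 l = (2, \<lambda>x\<in>cube 2. if x ! 0 = x ! 1 then 1 else l)"

text \<open>The operations below act on functions of arity k.  The new argument sits at position i.\<close>

definition add_fictitious :: "nat \<Rightarrow> nat \<Rightarrow> (bool list \<Rightarrow> real) \<Rightarrow> bfun"
  where "add_fictitious k i f = (Suc k, \<lambda>x\<in>cube (Suc k). f (take i x @ drop (Suc i) x))"

definition permute_args :: "nat \<Rightarrow> (nat \<Rightarrow> nat) \<Rightarrow> (bool list \<Rightarrow> real) \<Rightarrow> bfun"
  where "permute_args k p f = (k, \<lambda>x\<in>cube k. f (permute_list p x))"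

definition pointwise_prod :: "nat \<Rightarrow> (bool list \<Rightarrow> real) \<Rightarrow> (bool list \<Rightarrow> real) \<Rightarrow> bfun"
  where "pointwise_prod k f g = (k, \<lambda>x\<in>cube k. f x * g x)"

text \<open>Here f has arity k + 1 and the argument at position i is summed out.\<close>

definition sum_out :: "nat \<Rightarrow> nat \<Rightarrow> (bool list \<Rightarrow> real) \<Rightarrow> bfun"
  where "sum_out k i f = (k, \<lambda>x\<in>cube k. \<Sum>b\<in>UNIV. f (take i x @ b # drop i x))"

definition ops_closed :: "bfun set \<Rightarrow> bool"
  where "ops_closed C \<longleftrightarrow>
    (\<forall>k f i. (k, f) \<in> C \<and> i \<le> k \<longrightarrow> add_fictitious k i f \<in> C) \<and>
    (\<forall>k f p. (k, f) \<in> C \<and> p permutes {..<k} \<longrightarrow> permute_args k p f \<in> C) \<and>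
    (\<forall>k f g. (k, f) \<in> C \<and> (k, g) \<in> C \<longrightarrow> pointwise_prod k f g \<in> C) \<and>
    (\<forall>k f i. (Suc k, f) \<in> C \<and> i \<le> k \<longrightarrow> sum_out k i f \<in> C)"

definition clone :: "bfun set \<Rightarrow> bfun set"
  where "clone F = ops_closed hull (F \<union> {EQ})"

definition limit_of :: "bfun set \<Rightarrow> nat \<Rightarrow> (bool list \<Rightarrow> real) \<Rightarrow> bool"
  where "limit_of F k f \<longleftrightarrow> (k, f) \<in> BF_arity k \<and>
    (\<exists>S. finite S \<and> S \<subseteq> F \<and>
      (\<forall>e>0. \<exists>g. (k, g) \<in> clone S \<and> (MAX x\<in>cube k. \<bar>f x - g x\<bar>) < e))"

definition omega_closed :: "bfun set \<Rightarrow> bool"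
  where "omega_closed C \<longleftrightarrow> ops_closed C \<and> (\<forall>k f. limit_of C k f \<longrightarrow> (k, f) \<in> C)"

definition omega_clone :: "bfun set \<Rightarrow> bfun set"
  where "omega_clone F = omega_closed hull (F \<union> {EQ})"

text \<open>The intersections taken by the hulls are themselves closed.\<close>

lemma ops_closed_Inter:
  assumes "\<And>C. C \<in> \<C> \<Longrightarrow> ops_closed C"
  shows "ops_closed (\<Inter>\<C>)"
  unfolding ops_closed_def
proof (intro conjI allI impI InterI)
  fix k f i C assume "(k, f) \<in> \<Inter>\<C> \<and> i \<le> k" "C \<in> \<C>"
  then show "add_fictitious k i f \<in> C" using assms[of C] by (auto simp: ops_closed_def)
next
  fix k f p C assume "(k, f) \<in> \<Inter>\<C> \<and> p permutes {..<k}" "C \<in> \<C>"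
  then show "permute_args k p f \<in> C" using assms[of C] by (auto simp: ops_closed_def)
next
  fix k f g C assume "(k, f) \<in> \<Inter>\<C> \<and> (k, g) \<in> \<Inter>\<C>" "C \<in> \<C>"
  then show "pointwise_prod k f g \<in> C" using assms[of C] by (auto simp: ops_closed_def)
next
  fix k f i C assume "(Suc k, f) \<in> \<Inter>\<C> \<and> i \<le> k" "C \<in> \<C>"
  then show "sum_out k i f \<in> C" using assms[of C] by (auto simp: ops_closed_def)
qed

lemma limit_of_mono:
  assumes "limit_of F k f" "F \<subseteq> G"
  shows "limit_of G k f"
proof -
  obtain S where "(k, f) \<in> BF_arity k" "finite S" "S \<subseteq> F"
    and "\<forall>e>0. \<exists>g. (k, g) \<in> clone S \<and> (MAX x\<in>cube k. \<bar>f x - g x\<bar>) < e"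
    using assms(1) unfolding limit_of_def by blast
  then show ?thesis
    unfolding limit_of_def using subset_trans[OF _ assms(2)] by (intro conjI exI[of _ S]) auto
qed

lemma omega_closed_Inter:
  assumes "\<And>C. C \<in> \<C> \<Longrightarrow> omega_closed C"
  shows "omega_closed (\<Inter>\<C>)"
  unfolding omega_closed_def
proof (intro conjI allI impI InterI)
  show "ops_closed (\<Inter>\<C>)"
    using assms by (intro ops_closed_Inter) (simp add: omega_closed_def)
  fix k f C assume "limit_of (\<Inter>\<C>) k f" "C \<in> \<C>"
  then show "(k, f) \<in> C"
    using assms[of C] limit_of_mono[OF _ Inter_lower] by (auto simp: omega_closed_def)
qed

lemma ops_closed_clone: "ops_closed (clone F)"
  unfolding clone_def hull_def by (rule ops_closed_Inter) blast

lemma omega_closed_omega_clone: "omega_closed (omega_clone F)"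
  unfolding omega_clone_def hull_def by (rule omega_closed_Inter) blast

definition I_anti :: "bfun set"
  where "I_anti = omega_clone ({Ising2 l |l. l \<ge> 1} \<union> BF_arity 0)"

end

theory Submission
  imports Defs
begin

text \<open>
  Complement invariance is preserved by the four operations and by limits, which bounds
  \<^const>\<open>I_anti\<close> from above.  Conversely, if p and q are in the class and q has values in [0,1],
  then p times the indicator of q = 1 is the limit of p q^n, taken over the finite set {p, q}.  This
  yields disequality, hence all ferromagnetic Ising functions, and then the relations that exclude
  one complementary pair from the cube of dimension 3.  Such relations between a hidden bit y, the
  argument 0 and each argument i force y to differ from argument 0 unless the tuple agrees with a
  prescribed a up to complement; giving weight c - 1 to equality of the two and summing out y gives
  the function with an arbitrary value c \<ge> 1 on a and its complement and 1 elsewhere.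
  Their products are, up to a constant, all positive self-dual functions, and the limit above introduces zeros.
\<close>

lemma finite_cube [simp]: "finite (cube k)"
  using finite_lists_length_eq[of "UNIV :: bool set" k] by (simp add: cube_def)

lemma cube_nonempty [simp]: "cube k \<noteq> {}"
  using Ex_list_of_length[of k] by (auto simp: cube_def)

lemma map_Not_in_cube [simp]: "map Not x \<in> cube k \<longleftrightarrow> x \<in> cube k"
  by (simp add: cube_def)

section \<open>Self-dual functions form a closed class\<close>

lemma SD_iff:
  "(k, f) \<in> SD \<longleftrightarrow> f \<in> extensional (cube k) \<and> (\<forall>x\<in>cube k. 0 \<le> f x \<and> f (map Not x) = f x)"
proof -
  have "(k, f) \<in> SD \<longleftrightarrow> (k, f) \<in> BF_arity k \<and> (\<forall>x\<in>cube k. f (map Not x) = f x)"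
    unfolding SD_def BF_def BF_arity_def eq_commute[of "f (map Not _)"] by blast
  then show ?thesis by (auto simp: BF_arity_def PiE_iff)
qed

lemma SD_restrictI:
  assumes "\<And>x. x \<in> cube k \<Longrightarrow> 0 \<le> f x" "\<And>x. x \<in> cube k \<Longrightarrow> f (map Not x) = f x"
  shows "(k, restrict f (cube k)) \<in> SD"
  using assms by (simp add: SD_iff)

text \<open>Complementing a tuple commutes with deleting and permuting its entries; for a summed-out
  argument it only swaps the two summands.\<close>

lemma ops_closed_SD: "ops_closed SD"
  unfolding ops_closed_def
proof (intro conjI allI impI)
  fix k f i assume *: "(k, f) \<in> SD \<and> i \<le> k"
  have c: "take i x @ drop (Suc i) x \<in> cube k" if "x \<in> cube (Suc k)" for x
    using that * by (auto simp: cube_def)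
  show "add_fictitious k i f \<in> SD"
    unfolding add_fictitious_def
  proof (rule SD_restrictI)
    fix x assume "x \<in> cube (Suc k)"
    then show "0 \<le> f (take i x @ drop (Suc i) x)"
      and "f (take i (map Not x) @ drop (Suc i) (map Not x)) = f (take i x @ drop (Suc i) x)"
      using c[of x] * by (auto simp: SD_iff take_map drop_map simp flip: map_append)
  qed
next
  fix k f p assume *: "(k, f) \<in> SD \<and> p permutes {..<k}"
  have c: "permute_list p x \<in> cube k" if "x \<in> cube k" for x
    using that by (simp add: cube_def)
  show "permute_args k p f \<in> SD"
    unfolding permute_args_def
  proof (rule SD_restrictI)
    fix x assume x: "x \<in> cube k"
    have "permute_list p (map Not x) = map Not (permute_list p x)"
      using x * by (intro permute_list_map) (simp add: cube_def)
    then show "0 \<le> f (permute_list p x)" "f (permute_list p (map Not x)) = f (permute_list p x)"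
      using c[OF x] * by (auto simp: SD_iff)
  qed
next
  fix k f g assume "(k, f) \<in> SD \<and> (k, g) \<in> SD"
  then show "pointwise_prod k f g \<in> SD"
    unfolding pointwise_prod_def by (intro SD_restrictI) (auto simp: SD_iff)
next
  fix k f i assume *: "(Suc k, f) \<in> SD \<and> i \<le> k"
  have c: "take i x @ b # drop i x \<in> cube (Suc k)" if "x \<in> cube k" for x b
    using that * by (auto simp: cube_def)
  \<comment> \<open>Complementing the visible arguments with the hidden bit fixed amounts to
    complementing the whole tuple after negating that bit.\<close>
  have n: "f (take i (map Not x) @ b # drop i (map Not x)) = f (take i x @ (\<not> b) # drop i x)"
    if "x \<in> cube k" for x b
  proof -
    have "take i (map Not x) @ b # drop i (map Not x) = map Not (take i x @ (\<not> b) # drop i x)"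
      by (simp add: take_map drop_map)
    then show ?thesis using c[OF that] * by (metis SD_iff)
  qed
  show "sum_out k i f \<in> SD"
    unfolding sum_out_def
  proof (rule SD_restrictI)
    fix x assume x: "x \<in> cube k"
    show "0 \<le> (\<Sum>b\<in>UNIV. f (take i x @ b # drop i x))"
      using c[OF x] * by (intro sum_nonneg) (auto simp: SD_iff)
    show "(\<Sum>b\<in>UNIV. f (take i (map Not x) @ b # drop i (map Not x)))
        = (\<Sum>b\<in>UNIV. f (take i x @ b # drop i x))"
      unfolding n[OF x] by (simp add: UNIV_bool add.commute)
  qed
qed

lemma Ising2_in_SD:
  assumes "0 \<le> l" shows "Ising2 l \<in> SD"
  unfolding Ising2_def
proof (rule SD_restrictI)
  fix x assume "x \<in> cube 2"
  then have "length x = 2" by (simp add: cube_def)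
  then show "(if map Not x ! 0 = map Not x ! 1 then 1 else l) = (if x ! 0 = x ! 1 then 1 else l)"
    by simp
qed (use assms in simp)

lemma EQ_in_SD: "EQ \<in> SD"
  using Ising2_in_SD[of 0] by (simp add: EQ_def Ising2_def)

lemma BF_arity_0_subset_SD: "BF_arity 0 \<subseteq> SD"
proof
  fix z assume "z \<in> BF_arity 0"
  then obtain f where "z = (0, f)" "f \<in> cube 0 \<rightarrow>\<^sub>E {0..}"
    by (auto simp: BF_arity_def)
  then show "z \<in> SD" by (simp add: SD_iff PiE_iff cube_def)
qed

text \<open>If a limit took different values on a complementary pair, both would lie within less
  than half their gap of the single value that a self-dual approximant takes there, against the
  triangle inequality.\<close>

lemma omega_closed_SD: "omega_closed SD"
  unfolding omega_closed_def
proof (intro conjI allI impI ops_closed_SD)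
  fix k f assume "limit_of SD k f"
  then obtain S where f: "(k, f) \<in> BF_arity k" and S: "S \<subseteq> SD"
    and lim: "\<And>e. e > 0 \<Longrightarrow> \<exists>g. (k, g) \<in> clone S \<and> (MAX x\<in>cube k. \<bar>f x - g x\<bar>) < e"
    unfolding limit_of_def by blast
  have clone: "clone S \<subseteq> SD"
    unfolding clone_def using S EQ_in_SD ops_closed_SD by (intro hull_minimal) auto
  have "f (map Not x) = f x" if x: "x \<in> cube k" for x
  proof (rule ccontr)
    assume "f (map Not x) \<noteq> f x"
    then obtain g where g: "(k, g) \<in> SD"
      and "(MAX x\<in>cube k. \<bar>f x - g x\<bar>) < \<bar>f (map Not x) - f x\<bar> / 2"
      using lim[of "\<bar>f (map Not x) - f x\<bar> / 2"] clone by auto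
    then have close: "\<bar>f y - g y\<bar> < \<bar>f (map Not x) - f x\<bar> / 2" if "y \<in> cube k" for y
      using that by (subst (asm) Max_less_iff) auto
    have "g (map Not x) = g x" using g x by (simp add: SD_iff)
    moreover have "\<bar>f x - g x\<bar> < \<bar>f (map Not x) - f x\<bar> / 2"
      "\<bar>f (map Not x) - g (map Not x)\<bar> < \<bar>f (map Not x) - f x\<bar> / 2"
      using x by (simp_all only: close map_Not_in_cube)
    moreover have "\<bar>f (map Not x) - f x\<bar> \<le> \<bar>f x - g x\<bar> + \<bar>f (map Not x) - g x\<bar>"
      by linarith
    ultimately show False by simp
  qed
  then show "(k, f) \<in> SD"
    using f by (auto simp: SD_iff BF_arity_def PiE_iff)
qed

lemma I_anti_subset_SD: "I_anti \<subseteq> SD"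
  unfolding I_anti_def omega_clone_def
  using EQ_in_SD Ising2_in_SD BF_arity_0_subset_SD omega_closed_SD
  by (intro hull_minimal) auto

section \<open>Derived closure operations\<close>

text \<open>Restricting inside the definition lets members of a class be written as plain lambda
  terms, with no concern for their values off the cube.\<close>

definition rep :: "bfun set \<Rightarrow> nat \<Rightarrow> (bool list \<Rightarrow> real) \<Rightarrow> bool"
  where "rep C k f \<longleftrightarrow> (k, restrict f (cube k)) \<in> C"

lemma rep_cong:
  assumes "rep C k f" "\<And>x. x \<in> cube k \<Longrightarrow> f x = g x"
  shows "rep C k g"
proof -
  have "restrict f (cube k) = restrict g (cube k)"
    using assms(2) by (intro restrict_ext)
  then show ?thesis using assms(1) by (simp add: rep_def)
qed

lemma rep_mult:
  assumes "ops_closed C" "rep C k f" "rep C k g"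
  shows "rep C k (\<lambda>x. f x * g x)"
proof -
  have "pointwise_prod k (restrict f (cube k)) (restrict g (cube k)) \<in> C"
    using assms by (auto simp: ops_closed_def rep_def)
  moreover have "pointwise_prod k (restrict f (cube k)) (restrict g (cube k))
      = (k, \<lambda>x\<in>cube k. f x * g x)"
    by (auto simp: pointwise_prod_def)
  ultimately show ?thesis by (simp add: rep_def)
qed

lemma rep_sum:
  assumes "ops_closed C" "rep C (Suc k) f"
  shows "rep C k (\<lambda>x. f (False # x) + f (True # x))"
proof -
  have "sum_out k 0 (restrict f (cube (Suc k))) \<in> C"
    using assms by (auto simp: ops_closed_def rep_def)
  moreover have "sum_out k 0 (restrict f (cube (Suc k)))
      = (k, \<lambda>x\<in>cube k. f (False # x) + f (True # x))"
    by (auto simp: sum_out_def cube_def UNIV_bool)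
  ultimately show ?thesis by (simp add: rep_def)
qed

text \<open>The \<open>d\<close> fictitious arguments are appended at the end one by one, so the
  first \<open>m\<close> positions stay in place.\<close>

lemma rep_take:
  assumes "ops_closed C" "rep C m f"
  shows "rep C (m + d) (\<lambda>x. f (take m x))"
proof (induction d)
  case 0
  show ?case unfolding add_0_right using assms(2) by (rule rep_cong) (simp add: cube_def)
next
  case (Suc d)
  let ?g = "\<lambda>x\<in>cube (m + d). f (take m x)"
  have "add_fictitious (m + d) (m + d) ?g \<in> C"
    using assms(1) Suc by (auto simp: ops_closed_def rep_def)
  moreover have "add_fictitious (m + d) (m + d) ?g
      = (m + Suc d, \<lambda>x\<in>cube (m + Suc d). f (take m x))"
    by (auto simp: add_fictitious_def cube_def)
  ultimately show ?case by (simp add: rep_def)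
qed

text \<open>The complements of \<open>{..<m}\<close> and of its image in \<open>{..<k}\<close> have
  equal cardinality, so any bijection between them completes \<open>s\<close>.\<close>

lemma inj_on_extends_to_permutation:
  fixes s :: "nat \<Rightarrow> nat"
  assumes "inj_on s {..<m}" "s ` {..<m} \<subseteq> {..<k}" "m \<le> k"
  obtains p where "p permutes {..<k}" "\<And>i. i < m \<Longrightarrow> p i = s i"
proof -
  have "card ({..<k} - {..<m}) = card ({..<k} - s ` {..<m})"
    using assms by (simp add: card_Diff_subset card_image)
  then obtain t where t: "bij_betw t ({..<k} - {..<m}) ({..<k} - s ` {..<m})"
    using finite_same_card_bij[of "{..<k} - {..<m}" "{..<k} - s ` {..<m}"] by auto
  define p where "p i = (if i < m then s i else if i < k then t i else i)" for i
  have "bij_betw p {..<m} (s ` {..<m})"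
    using assms(1) by (subst bij_betw_cong[of _ p s]) (auto simp: p_def bij_betw_def)
  moreover have "bij_betw p ({..<k} - {..<m}) ({..<k} - s ` {..<m})"
    using t by (subst bij_betw_cong[of _ p t]) (auto simp: p_def)
  ultimately have "bij_betw p ({..<m} \<union> ({..<k} - {..<m})) (s ` {..<m} \<union> ({..<k} - s ` {..<m}))"
    by (intro bij_betw_combine) auto
  moreover have "{..<m} \<union> ({..<k} - {..<m}) = {..<k}" "s ` {..<m} \<union> ({..<k} - s ` {..<m}) = {..<k}"
    using assms by auto
  ultimately have "p permutes {..<k}"
    using assms(3) by (intro bij_imp_permutes) (auto simp: p_def)
  then show thesis by (rule that) (simp add: p_def)
qed

text \<open>Pad with fictitious arguments up to arity \<open>k\<close>, then permute so that the
  first \<open>m\<close> positions read the arguments chosen by \<open>s\<close>. This lets a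
  function of few arguments be applied at any distinct positions.\<close>

lemma rep_subst:
  assumes "ops_closed C" "rep C m f" "inj_on s {..<m}" "s ` {..<m} \<subseteq> {..<k}"
  shows "rep C k (\<lambda>x. f (map (\<lambda>i. x ! s i) [0..<m]))"
proof -
  have mk: "m \<le> k"
    using card_inj_on_le[OF assms(3,4)] by simp
  obtain p where p: "p permutes {..<k}" "\<And>i. i < m \<Longrightarrow> p i = s i"
    using inj_on_extends_to_permutation[OF assms(3,4) mk] by blast
  let ?g = "\<lambda>x\<in>cube k. f (take m x)"
  have "permute_args k p ?g \<in> C"
    using assms(1) rep_take[OF assms(1,2), of "k - m"] p(1) mk by (auto simp: ops_closed_def rep_def)
  moreover have "take m (permute_list p x) = map (\<lambda>i. x ! s i) [0..<m]" if "x \<in> cube k" for x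
    using that p(2) mk by (auto simp: permute_list_def cube_def take_map)
  then have "permute_args k p ?g = (k, \<lambda>x\<in>cube k. f (map (\<lambda>i. x ! s i) [0..<m]))"
    by (auto simp: permute_args_def cube_def intro!: restrict_ext)
  ultimately show ?thesis by (simp add: rep_def)
qed

lemma rep_const:
  assumes "ops_closed C" "BF_arity 0 \<subseteq> C" "0 \<le> c"
  shows "rep C k (\<lambda>x. c)"
proof -
  have "rep C 0 (\<lambda>x. c)"
    using assms(2,3) by (auto simp: rep_def BF_arity_def)
  from rep_take[OF assms(1) this, of k] show ?thesis by simp
qed

lemma rep_prod:
  assumes "ops_closed C" "BF_arity 0 \<subseteq> C" "finite A" "\<And>a. a \<in> A \<Longrightarrow> rep C k (f a)"
  shows "rep C k (\<lambda>x. \<Prod>a\<in>A. f a x)"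
  using assms(3,4)
proof (induction A rule: finite_induct)
  case empty
  show ?case using rep_const[OF assms(1,2), of 1 k] by simp
next
  case (insert a A)
  then have "rep C k (\<lambda>x. f a x * (\<Prod>a\<in>A. f a x))"
    by (intro rep_mult[OF assms(1)]) auto
  then show ?case using insert.hyps by simp
qed

lemma rep_limit:
  assumes C: "omega_closed C" and rep: "rep C k p" "rep C k q"
    and p: "\<And>x. x \<in> cube k \<Longrightarrow> 0 \<le> p x"
    and q: "\<And>x. x \<in> cube k \<Longrightarrow> 0 \<le> q x \<and> q x \<le> 1"
  shows "rep C k (\<lambda>x. if q x = 1 then p x else 0)"
proof -
  let ?f = "\<lambda>x\<in>cube k. if q x = 1 then p x else 0"
  \<comment> \<open>One finite set serves every accuracy; only the exponent \<open>n\<close> below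
    depends on \<open>e\<close>.\<close>
  let ?S = "{(k, restrict p (cube k)), (k, restrict q (cube k))}"
  have S: "?S \<subseteq> clone ?S"
    unfolding clone_def using hull_subset[of "?S \<union> {EQ}" ops_closed] by auto
  have pow: "rep (clone ?S) k (\<lambda>x. p x * q x ^ n)" for n
  proof (induction n)
    case 0
    have "rep (clone ?S) k p" unfolding rep_def using S by blast
    then show ?case by (simp only: power_0 mult_1_right)
  next
    case (Suc n)
    have "rep (clone ?S) k q" unfolding rep_def using S by blast
    from rep_mult[OF ops_closed_clone Suc this] show ?case by (simp only: power_Suc2 mult.assoc)
  qed
  have "limit_of C k ?f"
    unfolding limit_of_def
  proof (intro conjI exI[of _ ?S] allI impI)
    show "(k, ?f) \<in> BF_arity k" using p by (auto simp: BF_arity_def)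
    show "?S \<subseteq> C" using rep by (simp add: rep_def)
    fix e :: real assume e: "e > 0"
    have "\<forall>x\<in>cube k. \<forall>\<^sub>F n in sequentially. \<bar>?f x - p x * q x ^ n\<bar> < e"
    proof
      fix x assume x: "x \<in> cube k"
      have "(\<lambda>n. p x * q x ^ n) \<longlonglongrightarrow> ?f x"
      proof (cases "q x = 1")
        case False
        then have "(\<lambda>n. q x ^ n) \<longlonglongrightarrow> 0"
          using q[OF x] by (intro LIMSEQ_realpow_zero) auto
        from tendsto_mult_left[OF this, of "p x"] show ?thesis using False x by simp
      qed (use x in simp)
      from tendstoD[OF this e] show "\<forall>\<^sub>F n in sequentially. \<bar>?f x - p x * q x ^ n\<bar> < e"
        by (simp add: dist_real_def abs_minus_commute)
    qed
    \<comment> \<open>Finiteness of the cube turns pointwise convergence into uniform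
      convergence.\<close>
    then have "\<forall>\<^sub>F n in sequentially. \<forall>x\<in>cube k. \<bar>?f x - p x * q x ^ n\<bar> < e"
      by (intro eventually_ball_finite) auto
    then obtain n where n: "\<forall>x\<in>cube k. \<bar>?f x - p x * q x ^ n\<bar> < e"
      by (auto simp: eventually_sequentially)
    show "\<exists>g. (k, g) \<in> clone ?S \<and> (MAX x\<in>cube k. \<bar>?f x - g x\<bar>) < e"
      by (intro exI[of _ "\<lambda>x\<in>cube k. p x * q x ^ n"] conjI pow[of n, unfolded rep_def]
          iffD2[OF Max_less_iff]) (use n in auto)
  qed simp
  then show ?thesis
    using C by (simp add: omega_closed_def rep_def)
qed

section \<open>Generating the self-dual functions\<close>

locale anti_ising =
  fixes C :: "bfun set"
  assumes omega_closed: "omega_closed C"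
    and nullary: "BF_arity 0 \<subseteq> C"
    and Ising: "\<And>l. 1 \<le> l \<Longrightarrow> Ising2 l \<in> C"
begin

lemma ops_closed: "ops_closed C"
  using omega_closed by (simp add: omega_closed_def)

lemmas mult = rep_mult[OF ops_closed]
  and const_fun = rep_const[OF ops_closed nullary]
  and product = rep_prod[OF ops_closed nullary]
  and summation = rep_sum[OF ops_closed]
  and limit = rep_limit[OF omega_closed]

lemma anti_pair:
  assumes "i < k" "j < k" "i \<noteq> j" "1 \<le> l"
  shows "rep C k (\<lambda>x. if x ! i = x ! j then 1 else l)"
proof -
  have "rep C 2 (\<lambda>x. if x ! 0 = x ! 1 then 1 else l)"
    using Ising[OF assms(4)] by (simp add: rep_def Ising2_def)
  moreover have "inj_on (\<lambda>n::nat. if n = 0 then i else j) {..<2}"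
    using assms by (auto simp: inj_on_def)
  moreover have "(\<lambda>n::nat. if n = 0 then i else j) ` {..<2} \<subseteq> {..<k}"
    using assms by auto
  ultimately have "rep C k (\<lambda>x. (\<lambda>y. if y ! 0 = y ! 1 then 1 else l)
      (map (\<lambda>n. x ! (if n = 0 then i else j)) [0..<2]))"
    by (rule rep_subst[OF ops_closed])
  then show ?thesis by (rule rep_cong) simp
qed

lemma neq_pair:
  assumes "i < k" "j < k" "i \<noteq> j"
  shows "rep C k (\<lambda>x. if x ! i = x ! j then 0 else 1)"
proof -
  \<comment> \<open>Halving \<open>Ising2 2\<close> gives 1/2 on equality and 1 on disequality, so
    the limit of powers keeps only disequality.\<close>
  have "rep C k (\<lambda>x. 1 / 2 * (if x ! i = x ! j then 1 else 2))"
    using assms by (intro mult const_fun anti_pair) auto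
  from limit[OF const_fun[of 1] this] show ?thesis
    by (rule rep_cong) auto
qed

lemma pair:
  assumes ij: "i < k" "j < k" "i \<noteq> j" and ab: "0 \<le> a" "0 \<le> b"
  shows "rep C k (\<lambda>x. if x ! i = x ! j then a else b)"
proof -
  have le: "rep C k' (\<lambda>x. if x ! i' = x ! j' then a' else b')"
    if "i' < k'" "j' < k'" "i' \<noteq> j'" "0 \<le> a'" "a' \<le> b'" for k' i' j' a' b'
  proof (cases "a' = 0")
    case True
    have "rep C k' (\<lambda>x. b' * (if x ! i' = x ! j' then 0 else 1))"
      using that by (intro mult const_fun neq_pair) auto
    then show ?thesis by (rule rep_cong) (simp add: True)
  next
    case False
    have "rep C k' (\<lambda>x. a' * (if x ! i' = x ! j' then 1 else b' / a'))"
      using that False by (intro mult const_fun anti_pair) (auto simp: field_simps)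
    then show ?thesis by (rule rep_cong) (simp add: False)
  qed
  show ?thesis
  proof (cases "a \<le> b")
    case True
    then show ?thesis using le assms by blast
  next
    case False
    \<comment> \<open>The hidden bit at position 0 is forced to be the negation of argument
      \<open>i\<close>, so comparing it with argument \<open>j\<close> exchanges equality and
      disequality. This reaches the ferromagnetic case \<open>b < a\<close>.\<close>
    have "rep C (Suc k) (\<lambda>x. (if x ! 0 = x ! Suc i then 0 else 1) * (if x ! 0 = x ! Suc j then b else a))"
      using ij ab False by (intro mult neq_pair le) auto
    from summation[OF this] show ?thesis by (rule rep_cong) auto
  qed
qed

text \<open>If arguments \<open>h\<close> and \<open>i\<close> agree, the two factors
  \<open>?P\<close> coincide and multiply to 1/4 on the excluded pair and to 1 otherwise. If they
  differ, exactly one factor is 1/2, which the weight 2 cancels. The limit then removes the value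
  1/4.\<close>

lemma exclude:
  assumes "h < k" "i < k" "j < k" "h \<noteq> i" "h \<noteq> j" "i \<noteq> j"
  shows "rep C k (\<lambda>x. if x ! h = x ! i \<and> (x ! i = x ! j) = s then 0 else 1)"
proof -
  let ?P = "\<lambda>i j x. if ((x :: bool list) ! i = x ! j) = s then 1 / 2 else 1 :: real"
  have P: "rep C k (?P i j)" if "i < k" "j < k" "i \<noteq> j" for i j
    by (rule rep_cong[OF pair[OF that, of "if s then 1/2 else 1" "if s then 1 else 1/2"]]) auto
  have "rep C k (\<lambda>x. (if x ! h = x ! i then 1 else 2) * (?P h j x * ?P i j x))"
    using assms by (intro mult pair P) auto
  from limit[OF const_fun[of 1] this] show ?thesis
    by (rule rep_cong) (auto split: if_splits)
qed

lemma bump: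
  assumes "0 < k" "1 \<le> c"
  shows "rep C k (\<lambda>x. if \<forall>i<k. (x ! 0 = x ! i) = (a ! 0 = a ! i) then c else 1)"
proof -
  \<comment> \<open>Position 0 holds the hidden bit, so argument \<open>i\<close> of the final
    function sits at \<open>Suc i\<close>. A factor vanishes when the hidden bit equals argument 0
    and argument \<open>i\<close> witnesses disagreement with \<open>a\<close>.\<close>
  let ?R = "\<lambda>i x. if (x :: bool list) ! 0 = x ! Suc 0 \<and> (x ! Suc 0 = x ! Suc i) = (a ! 0 \<noteq> a ! i)
      then 0 else 1 :: real"
  have "rep C (Suc k) (\<lambda>x. (if x ! 0 = x ! Suc 0 then c - 1 else 1) * (\<Prod>i\<in>{1..<k}. ?R i x))"
    using assms by (intro mult pair product exclude) auto
  from summation[OF this] show ?thesis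
  proof (rule rep_cong)
    fix x :: "bool list"
    \<comment> \<open>The condition at \<open>i = 0\<close> is trivial. The product starts at 1
      because \<open>exclude\<close> needs three distinct positions.\<close>
    have all: "(\<forall>i<k. (x ! 0 = x ! i) = (a ! 0 = a ! i)) \<longleftrightarrow>
        (\<forall>i\<in>{1..<k}. (x ! 0 = x ! i) = (a ! 0 = a ! i))"
      by (metis atLeastLessThan_iff less_one linorder_not_less)
    \<comment> \<open>A hidden bit equal to argument 0 contributes \<open>c - 1\<close> exactly on
      \<open>a\<close> and its complement; the opposite bit always contributes 1.\<close>
    have on: "(\<Prod>i\<in>{1..<k}. ?R i (x ! 0 # x))
        = (if \<forall>i<k. (x ! 0 = x ! i) = (a ! 0 = a ! i) then 1 else 0)"
      unfolding all by (auto simp: prod_zero_iff intro!: prod.neutral)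
    have off: "(\<Prod>i\<in>{1..<k}. ?R i ((\<not> x ! 0) # x)) = 1"
      by (intro prod.neutral) auto
    show "(if (False # x) ! 0 = (False # x) ! Suc 0 then c - 1 else 1) * (\<Prod>i\<in>{1..<k}. ?R i (False # x))
      + (if (True # x) ! 0 = (True # x) ! Suc 0 then c - 1 else 1) * (\<Prod>i\<in>{1..<k}. ?R i (True # x))
      = (if \<forall>i<k. (x ! 0 = x ! i) = (a ! 0 = a ! i) then c else 1)"
      using on off by (cases "x ! 0") auto
  qed
qed

lemma positive_self_dual:
  assumes k: "0 < k" and pos: "\<And>x. x \<in> cube k \<Longrightarrow> 0 < f x"
    and dual: "\<And>x. x \<in> cube k \<Longrightarrow> f (map Not x) = f x"
  shows "rep C k f"
proof -
  \<comment> \<open>Dividing by the minimum makes every ratio \<open>f a / m\<close> at least 1, as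
    \<open>bump\<close> requires.\<close>
  define m where "m = Min (f ` cube k)"
  have m: "m \<le> f x" if "x \<in> cube k" for x
    using that by (simp add: m_def)
  have m0: "0 < m"
    unfolding m_def using pos by (subst Min_gr_iff) auto
  \<comment> \<open>One representative of each complementary pair, namely the tuple that starts with
    \<open>False\<close>.\<close>
  let ?A = "{a \<in> cube k. \<not> a ! 0}"
  let ?D = "\<lambda>a x. if \<forall>i<k. (x ! 0 = x ! i) = (a ! 0 = a ! i) then f a / m else 1"
  have "rep C k (\<lambda>x. m * (\<Prod>a\<in>?A. ?D a x))"
    using k m m0 by (intro mult const_fun product bump) (auto simp: field_simps)
  then show ?thesis
  proof (rule rep_cong)
    fix x assume x: "x \<in> cube k"
    \<comment> \<open>The representative in \<open>?A\<close> of the pair of \<open>x\<close>; only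
      its factor differs from 1 at \<open>x\<close>, or is allowed to.\<close>
    define y where "y = (if x ! 0 then map Not x else x)"
    have y: "y \<in> ?A" using x k by (auto simp: y_def cube_def)
    have fy: "f y = f x" using x dual by (simp add: y_def)
    have iff: "(\<forall>i<k. (x ! 0 = x ! i) = (a ! 0 = a ! i)) \<longleftrightarrow> a = y" if "a \<in> ?A" for a
    proof -
      have "length a = k" "length x = k" "length y = k" "\<not> a ! 0"
        using that x by (auto simp: cube_def y_def)
      then show ?thesis
        using k by (subst list_eq_iff_nth_eq) (auto simp: y_def)
    qed
    have "(\<Prod>a\<in>?A. ?D a x) = (\<Prod>a\<in>?A. if a = y then f a / m else 1)"
      by (intro prod.cong refl if_cong iff)
    also have "\<dots> = f x / m"
      using y fy by (subst prod.delta) auto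
    finally show "m * (\<Prod>a\<in>?A. ?D a x) = f x" using m0 by simp
  qed
qed

lemma SD_subset: "SD \<subseteq> C"
proof
  fix z assume "z \<in> SD"
  then obtain k f where z: "z = (k, f)" and f: "(k, f) \<in> SD" by (cases z) auto
  have ext: "restrict f (cube k) = f"
    using f by (auto simp: SD_iff intro: extensional_restrict)
  have "rep C k f"
  proof (cases "k = 0")
    \<comment> \<open>Without an argument 0 there is no reference bit for
      \<open>positive_self_dual\<close>, but nullary functions are generators.\<close>
    case True
    then have "(k, f) \<in> BF_arity 0" using f by (auto simp: SD_def BF_def BF_arity_def)
    then show ?thesis using nullary ext by (auto simp: rep_def)
  next
    case False
    \<comment> \<open>Both functions are positive and self-dual: \<open>?p\<close> fills the zeros
      of \<open>f\<close> with 1, and \<open>?q\<close> marks them with 1/2 for the limit to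
      erase.\<close>
    let ?p = "\<lambda>x. if f x = 0 then 1 else f x" and ?q = "\<lambda>x. if f x = 0 then 1 / 2 else 1 :: real"
    have f0: "0 \<le> f x" and dual: "f (map Not x) = f x" if "x \<in> cube k" for x
      using f that by (auto simp: SD_iff)
    have "rep C k ?p"
      proof (rule positive_self_dual)
      fix x assume "x \<in> cube k"
      then show "0 < ?p x" "?p (map Not x) = ?p x"
        using f0[of x] dual[of x] by simp_all
    qed (use False in simp)
    moreover have "rep C k ?q"
      by (rule positive_self_dual) (use False dual in simp_all)
    ultimately have "rep C k (\<lambda>x. if ?q x = 1 then ?p x else 0)"
      by (rule limit) (simp_all add: f0)
    then show ?thesis by (rule rep_cong) auto
  qed
  then show "z \<in> C" by (simp add: rep_def ext z)
qed

end

theorem theorem7p12: "SD = I_anti"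
proof
  have gen: "{Ising2 l |l. l \<ge> 1} \<union> BF_arity 0 \<union> {EQ} \<subseteq> I_anti"
    unfolding I_anti_def omega_clone_def by (rule hull_subset)
  interpret anti_ising I_anti
  proof
    show "omega_closed I_anti"
      unfolding I_anti_def by (rule omega_closed_omega_clone)
    show "BF_arity 0 \<subseteq> I_anti" "\<And>l. 1 \<le> l \<Longrightarrow> Ising2 l \<in> I_anti"
      using gen by blast+
  qed
  show "SD \<subseteq> I_anti" by (rule SD_subset)
  show "I_anti \<subseteq> SD" by (rule I_anti_subset_SD)
qed

end
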